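(* Let $K/\mathbb Q$ be a finite extension with ring of integers $\mathcal O$. Let $\theta\in\mathbb R$ be a Pisot–Vijayaraghavan number such that $\theta=\tau(\vartheta)$ for some $\vartheta\in\mathcal O$ and some embedding $\tau:K\hookrightarrow\mathbb C$, and such that $\prod_{\tau'}(X-\tau'(\vartheta))\in\mathbb Z[X]$ (product over all embeddings $\tau':K\hookrightarrow\mathbb C$) is the minimal polynomial of $\theta$. Regard $\theta\in\mathbb R\subset\mathbb K$ via the diagonal embedding. Then there exists $\mu\in\mathbb P\mathbb K_\varepsilon$ such that ${}^*\mathcal O^{\mu}_{\mu}(\theta)\neq0$.
   Context: A Pisot–Vijayaraghavan number is a real algebraic integer $>1$ all of whose other conjugates have absolute value $<1$. Fix a nonprincipal ultrafilter on $\mathbb N$ and denote ultrapowers with ${}^*$. Let ${}^*\mathbb R_{\rm fin}$ be the bounded elements of ${}^*\mathbb R$ and $({}^*\mathbb R_{\rm fin})^\times_+$ the positive elements neither infinite nor infinitesimal. Let $\mathbb P:=({}^*\mathbb R_{>0}\cup\{0\})/({}^*\mathbb R_{\rm fin})^\times_+$, with induced product and total order, $-\infty:=$ class of $0$ (the minimum); for $x\in{}^*\mathbb C$ let $\langle x\rangle\in\mathbb P$ be the class of $|x|$. Let $d=[K:\mathbb Q]$. The Minkowski space is $\mathbb K:=\{z=(z_\tau)\in\mathbb C^d:\overline{z_\tau}=z_{\overline\tau}\}$, coordinates indexed by the $d$ embeddings $\tau:K\hookrightarrow\mathbb C$. $K$ is embedded in $\mathbb K$ by $\alpha\mapsto(\tau(\alpha))_\tau$,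 and $\mathbb R\subset\mathbb K$ by $\theta\mapsto(\theta,\dots,\theta)$; correspondingly ${}^*\mathcal O\subset{}^*\mathbb K$. ${}^*\mathbb K_\varepsilon$ is the set of elements of ${}^*\mathbb K$ all of whose coordinates are infinitesimal (possibly zero). $\mathbb P\mathbb K$ is the set of tuples $(\langle z_\tau\rangle)_\tau$, $z\in{}^*\mathbb K$, i.e. tuples $(\mu_\tau)\in\mathbb P^d$ with $\mu_\tau=\mu_{\overline\tau}$, with coordinatewise product; write $\langle z\rangle=(\langle z_\tau\rangle)_\tau$ and order tuples by $\le$ coordinatewise. $\mathbb P\mathbb K_\varepsilon$ is the image of ${}^*\mathbb K_\varepsilon$ (coordinates equal to $-\infty$ allowed). For $z\in\mathbb K$, ${}^*\mathcal O(z)$ is the group of $\alpha\in{}^*\mathcal O$ for which there is a (unique) $\alpha^\perp\in{}^*\mathcal O$ with $\varepsilon(\alpha):=\alpha z-\alpha^\perp\in{}^*\mathbb K_\varepsilon$. For $\mu,\nu\in\mathbb P\mathbb K_\varepsilon$, $${}^*\mathcal O^\mu_\nu(z):=\{\alpha\in{}^*\mathcal O(z):\ \langle\alpha\rangle\cdot\mu\in\mathbb P\mathbb K_\varepsilon,\ \langle\varepsilon(\alpha)\rangle\le\nu\}.$$ *)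

theory Defs
  imports "HOL-Analysis.Analysis" "HOL-Computational_Algebra.Computational_Algebra"
begin

section \<open>Ultrapowers\<close>

definition nonprincipal_ultrafilter :: "nat filter \<Rightarrow> bool" where
  "nonprincipal_ultrafilter U \<longleftrightarrow>
     U \<noteq> bot \<and>
     (\<forall>P. eventually P U \<or> eventually (\<lambda>n. \<not> P n) U) \<and>
     (\<forall>n. U \<noteq> principal {n})"

text \<open>
  The ultrafilter is a parameter, so the ultrapower of a type is not itself a type: its elements
  are the equivalence classes of sequences modulo eventual equality along \<^term>\<open>U\<close>.
\<close>

type_synonym 'a star = "(nat \<Rightarrow> 'a) set"

definition ultra_rel :: "nat filter \<Rightarrow> ((nat \<Rightarrow> 'a) \<times> (nat \<Rightarrow> 'a)) set" where
  "ultra_rel U = {(f, g). eventually (\<lambda>n. f n = g n) U}"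

definition star_class :: "nat filter \<Rightarrow> (nat \<Rightarrow> 'a) \<Rightarrow> 'a star" where
  "star_class U f = ultra_rel U `` {f}"

definition star_of :: "nat filter \<Rightarrow> 'a \<Rightarrow> 'a star" where
  "star_of U a = star_class U (\<lambda>_. a)"

definition star :: "nat filter \<Rightarrow> 'a set \<Rightarrow> 'a star set" where
  "star U A = {star_class U f | f. \<forall>n. f n \<in> A}"

text \<open>
  Extensions of functions and relations to ultrapowers; on classes of sequences they act
  pointwise on representatives.
\<close>

definition star_map :: "nat filter \<Rightarrow> ('a \<Rightarrow> 'b) \<Rightarrow> 'a star \<Rightarrow> 'b star" where
  "star_map U h x = {g. \<exists>f\<in>x. eventually (\<lambda>n. g n = h (f n)) U}"

definition star_map2 :: "nat filter \<Rightarrow> ('a \<Rightarrow> 'b \<Rightarrow> 'c) \<Rightarrow> 'a star \<Rightarrow> 'b star \<Rightarrow> 'c star" where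
  "star_map2 U h x y = {k. \<exists>f\<in>x. \<exists>g\<in>y. eventually (\<lambda>n. k n = h (f n) (g n)) U}"

definition star_rel :: "nat filter \<Rightarrow> ('a \<Rightarrow> 'b \<Rightarrow> bool) \<Rightarrow> 'a star \<Rightarrow> 'b star \<Rightarrow> bool" where
  "star_rel U R x y \<longleftrightarrow> (\<exists>f\<in>x. \<exists>g\<in>y. eventually (\<lambda>n. R (f n) (g n)) U)"

definition bounded_star :: "nat filter \<Rightarrow> 'a::real_normed_vector star \<Rightarrow> bool" where
  "bounded_star U x \<longleftrightarrow> (\<exists>C::real. star_rel U (\<le>) (star_map U norm x) (star_of U C))"

definition infinitesimal :: "nat filter \<Rightarrow> 'a::real_normed_vector star \<Rightarrow> bool" where
  "infinitesimal U x \<longleftrightarrow> (\<forall>r::real. r > 0 \<longrightarrow> star_rel U (<) (star_map U norm x) (star_of U r))"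


section \<open>Growth classes\<close>

definition fin_units_pos :: "nat filter \<Rightarrow> real star set" where
  "fin_units_pos U =
     {x \<in> star U UNIV. star_rel U (<) (star_of U 0) x \<and> bounded_star U x \<and> \<not> infinitesimal U x}"

text \<open>
  An element of \<open>\<PP>\<close> is an orbit of the group of positive finite non-infinitesimal hyperreals
  acting by multiplication on the nonnegative hyperreals.
\<close>

type_synonym growth = "real star set"

definition growth_class :: "nat filter \<Rightarrow> real star \<Rightarrow> growth" where
  "growth_class U x = (\<lambda>u. star_map2 U (*) u x) ` fin_units_pos U"

definition growth_mult :: "nat filter \<Rightarrow> growth \<Rightarrow> growth \<Rightarrow> growth" where
  "growth_mult U p q = {star_map2 U (*) x y | x y. x \<in> p \<and> y \<in> q}"

definition growth_le :: "nat filter \<Rightarrow> growth \<Rightarrow> growth \<Rightarrow> bool" where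
  "growth_le U p q \<longleftrightarrow> (\<exists>x\<in>p. \<exists>y\<in>q. star_rel U (\<le>) x y)"

definition abs_class :: "nat filter \<Rightarrow> complex star \<Rightarrow> growth" where
  "abs_class U x = growth_class U (star_map U cmod x)"


section \<open>Number fields and Minkowski space\<close>

definition number_field :: "'k::field_char_0 itself \<Rightarrow> bool" where
  "number_field _ \<longleftrightarrow>
     (\<exists>B::'k set. finite_dimensional_vector_space (\<lambda>(r::rat) (x::'k). of_rat r * x) B)"

definition ring_of_integers :: "'k::field_char_0 set" where
  "ring_of_integers = {x. algebraic_int x}"

definition embeddings :: "('k::field_char_0 \<Rightarrow> complex) set" where
  "embeddings =
     {\<tau>. \<tau> 1 = 1 \<and> (\<forall>x y. \<tau> (x + y) = \<tau> x + \<tau> y) \<and> (\<forall>x y. \<tau> (x * y) = \<tau> x * \<tau> y)}"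

text \<open>Tuples indexed by the embeddings are extensional functions on \<^const>\<open>embeddings\<close>.\<close>

type_synonym 'k mink = "('k \<Rightarrow> complex) \<Rightarrow> complex"

definition minkowski_space :: "'k::field_char_0 mink set" where
  "minkowski_space =
     {z \<in> extensional embeddings. \<forall>\<tau>\<in>embeddings. cnj (z \<tau>) = z (\<lambda>x. cnj (\<tau> x))}"

definition mink_embed :: "'k::field_char_0 \<Rightarrow> 'k mink" where
  "mink_embed \<alpha> = (\<lambda>\<tau>\<in>embeddings. \<tau> \<alpha>)"

definition mink_diag :: "real \<Rightarrow> 'k::field_char_0 mink" where
  "mink_diag t = (\<lambda>\<tau>\<in>embeddings. complex_of_real t)"

definition mink_mult :: "'k::field_char_0 mink \<Rightarrow> 'k mink \<Rightarrow> 'k mink" where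
  "mink_mult z w = (\<lambda>\<tau>\<in>embeddings. z \<tau> * w \<tau>)"

definition mink_diff :: "'k::field_char_0 mink \<Rightarrow> 'k mink \<Rightarrow> 'k mink" where
  "mink_diff z w = (\<lambda>\<tau>\<in>embeddings. z \<tau> - w \<tau>)"

definition star_coord :: "nat filter \<Rightarrow> ('k::field_char_0 \<Rightarrow> complex) \<Rightarrow> 'k mink star \<Rightarrow> complex star" where
  "star_coord U \<tau> z = star_map U (\<lambda>w. w \<tau>) z"

definition mink_eps :: "nat filter \<Rightarrow> 'k::field_char_0 mink star set" where
  "mink_eps U =
     {z \<in> star U minkowski_space. \<forall>\<tau>\<in>embeddings. infinitesimal U (star_coord U \<tau> z)}"

type_synonym 'k mink_growth = "('k \<Rightarrow> complex) \<Rightarrow> growth"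

definition mink_class :: "nat filter \<Rightarrow> 'k::field_char_0 mink star \<Rightarrow> 'k mink_growth" where
  "mink_class U z = (\<lambda>\<tau>\<in>embeddings. abs_class U (star_coord U \<tau> z))"

definition mink_growth_mult ::
    "nat filter \<Rightarrow> 'k::field_char_0 mink_growth \<Rightarrow> 'k mink_growth \<Rightarrow> 'k mink_growth" where
  "mink_growth_mult U \<mu> \<nu> = (\<lambda>\<tau>\<in>embeddings. growth_mult U (\<mu> \<tau>) (\<nu> \<tau>))"

definition mink_growth_le ::
    "nat filter \<Rightarrow> 'k::field_char_0 mink_growth \<Rightarrow> 'k mink_growth \<Rightarrow> bool" where
  "mink_growth_le U \<mu> \<nu> \<longleftrightarrow> (\<forall>\<tau>\<in>embeddings. growth_le U (\<mu> \<tau>) (\<nu> \<tau>))"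

definition PK_eps :: "nat filter \<Rightarrow> 'k::field_char_0 mink_growth set" where
  "PK_eps U = mink_class U ` mink_eps U"


section \<open>Diophantine approximation groups\<close>

definition star_embed :: "nat filter \<Rightarrow> 'k::field_char_0 star \<Rightarrow> 'k mink star" where
  "star_embed U \<alpha> = star_map U mink_embed \<alpha>"

definition approx_error :: "nat filter \<Rightarrow> 'k::field_char_0 mink \<Rightarrow> 'k star \<Rightarrow> 'k star \<Rightarrow> 'k mink star" where
  "approx_error U z \<alpha> \<beta> =
     star_map2 U mink_diff (star_map2 U mink_mult (star_embed U \<alpha>) (star_of U z)) (star_embed U \<beta>)"

definition dioph_group :: "nat filter \<Rightarrow> 'k::field_char_0 mink \<Rightarrow> 'k star set" where
  "dioph_group U z =
     {\<alpha> \<in> star U ring_of_integers. \<exists>\<beta>\<in>star U ring_of_integers. approx_error U z \<alpha> \<beta> \<in> mink_eps U}"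

text \<open>
  For \<open>\<alpha>\<close> in the Diophantine approximation group over a number field, \<open>\<alpha>\<^sup>\<bottom>\<close> is unique because the
  only algebraic integer all of whose conjugates have absolute value \<open>< 1\<close> is \<open>0\<close>.
\<close>

definition perp :: "nat filter \<Rightarrow> 'k::field_char_0 mink \<Rightarrow> 'k star \<Rightarrow> 'k star" where
  "perp U z \<alpha> = (THE \<beta>. \<beta> \<in> star U ring_of_integers \<and> approx_error U z \<alpha> \<beta> \<in> mink_eps U)"

definition err :: "nat filter \<Rightarrow> 'k::field_char_0 mink \<Rightarrow> 'k star \<Rightarrow> 'k mink star" where
  "err U z \<alpha> = approx_error U z \<alpha> (perp U z \<alpha>)"

definition dioph_group_growth_decay ::
    "nat filter \<Rightarrow> 'k::field_char_0 mink_growth \<Rightarrow> 'k mink_growth \<Rightarrow> 'k mink \<Rightarrow> 'k star set" where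
  "dioph_group_growth_decay U \<mu> \<nu> z =
     {\<alpha> \<in> dioph_group U z.
        mink_growth_mult U (mink_class U (star_embed U \<alpha>)) \<mu> \<in> PK_eps U \<and>
        mink_growth_le U (mink_class U (err U z \<alpha>)) \<nu>}"


section \<open>Pisot--Vijayaraghavan numbers\<close>

definition is_min_poly :: "rat poly \<Rightarrow> 'a::field_char_0 \<Rightarrow> bool" where
  "is_min_poly p x \<longleftrightarrow>
     lead_coeff p = 1 \<and> poly (map_poly of_rat p) x = 0 \<and>
     (\<forall>q. q \<noteq> 0 \<and> poly (map_poly of_rat q) x = 0 \<longrightarrow> degree p \<le> degree q)"

definition conjugates :: "'a::field_char_0 \<Rightarrow> complex set" where
  "conjugates x = {w. \<exists>p. is_min_poly p x \<and> poly (map_poly of_rat p) w = 0}"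

definition pisot_vijayaraghavan :: "real \<Rightarrow> bool" where
  "pisot_vijayaraghavan t \<longleftrightarrow>
     algebraic_int t \<and> t > 1 \<and> (\<forall>w \<in> conjugates t - {complex_of_real t}. cmod w < 1)"

end

theory Submission
  imports Defs "Jordan_Normal_Form.Char_Poly"
begin

text \<open>
  Take \<open>\<alpha> = (\<vartheta>\<^sup>n)\<^sub>n\<close> and \<open>\<alpha>\<^sup>\<bottom> = (\<vartheta>\<^sup>n\<^sup>+\<^sup>1)\<^sub>n\<close>. The error has coordinates \<open>\<sigma>(\<vartheta>)\<^sup>n (\<theta> - \<sigma>(\<vartheta>))\<close>: it vanishes at the
  single embedding with \<open>\<sigma>(\<vartheta>) = \<theta>\<close> and is infinitesimal at all others, where \<open>|\<sigma>(\<vartheta>)| < 1\<close>. With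
  \<open>\<mu>\<close> the class of the error, \<open>\<langle>\<alpha>\<rangle> \<mu>\<close> vanishes at the same embedding and is infinitesimal at the
  others.

  What remains is the uniqueness of \<open>\<alpha>\<^sup>\<bottom>\<close>: if \<open>x\<close>, \<open>y\<close> are algebraic integers and \<open>d = x - y\<close> has
  \<open>|\<sigma>(d)| < 1\<close> for all embeddings, then \<open>d = 0\<close>. Let \<open>K\<close> act on the rational-linear maps
  \<open>f: K \<rightarrow> \<complex>\<close> by \<open>(a f)(b) = f(a b)\<close>. Common eigenvectors of this action are multiples of embeddings,
  so the eigenvalues of \<open>d\<close> are the numbers \<open>\<sigma>(d)\<close>, and therefore \<open>f(d\<^sup>n) \<rightarrow> 0\<close> for every \<open>f\<close>. For a coordinate
  functional \<open>f\<close> of a rational basis the values \<open>f(d\<^sup>n)\<close> have a common denominator because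
  \<open>\<int>[x, y]\<close> is finitely generated, so they are eventually \<open>0\<close>; hence \<open>d\<^sup>n = 0\<close> for some \<open>n\<close>.
\<close>

section \<open>Rational functionals and embeddings\<close>

definition rat_linear :: "('k::field_char_0 \<Rightarrow> complex) \<Rightarrow> bool" where
  "rat_linear f \<longleftrightarrow> (\<forall>a b. f (a + b) = f a + f b) \<and> (\<forall>r a. f (of_rat r * a) = of_rat r * f a)"

lemma rat_linear_0: "rat_linear f \<Longrightarrow> f 0 = 0"
  unfolding rat_linear_def by (metis mult_zero_left of_rat_0)

lemma rat_linear_of_int: "rat_linear f \<Longrightarrow> f (of_int k * a) = of_int k * f a"
  unfolding rat_linear_def by (metis of_rat_of_int_eq)

lemma rat_linear_sum: "rat_linear f \<Longrightarrow> f (\<Sum>i\<in>I. g i) = (\<Sum>i\<in>I. f (g i))"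
  by (induction I rule: infinite_finite_induct) (auto simp: rat_linear_0, auto simp: rat_linear_def)

lemma rat_linear_eigen_shift:
  assumes "rat_linear f"
  shows "rat_linear (\<lambda>b. f (a * b) - w * f b)"
proof -
  have "f (a * (of_rat r * x)) = of_rat r * f (a * x)" for r x
    using assms unfolding rat_linear_def by (metis mult.left_commute)
  then show ?thesis
    using assms unfolding rat_linear_def by (simp add: algebra_simps)
qed

text \<open>This is \<open>p(T) f\<close> for the operator \<open>(T f)(b) = f (a * b)\<close>. The
  coefficients multiply the values of \<open>f\<close>, so they may be complex although the field
  need not contain them.\<close>

definition apply_poly :: "complex poly \<Rightarrow> 'k::field_char_0 \<Rightarrow> ('k \<Rightarrow> complex) \<Rightarrow> 'k \<Rightarrow> complex" where
  "apply_poly p a f b = (\<Sum>i\<le>degree p. coeff p i * f (a ^ i * b))"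

lemma apply_poly_altdef:
  assumes "degree p \<le> N"
  shows "apply_poly p a f b = (\<Sum>i\<le>N. coeff p i * f (a ^ i * b))"
  unfolding apply_poly_def using assms
  by (intro sum.mono_neutral_left) (auto simp: coeff_eq_0)

text \<open>In operator notation, \<open>((X - w) q)(T) = q(T) (T - w)\<close>. The inductions on
  the degree of an annihilating polynomial peel off one root at a time with it.\<close>

lemma apply_poly_linear_factor:
  "apply_poly ([:-w, 1:] * q) a f = apply_poly q a (\<lambda>b. f (a * b) - w * f b)"
proof
  fix b
  let ?N = "degree q"
  have eq: "[:-w, 1:] * q = Polynomial.smult (-w) q + pCons 0 q" by simp
  have deg: "degree ([:-w, 1:] * q) \<le> Suc ?N"
    using degree_mult_le[of "[:-w, 1:]" q] by simp
  have "apply_poly ([:-w, 1:] * q) a f b =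
      (\<Sum>i\<le>Suc ?N. - w * (coeff q i * f (a ^ i * b)))
      + (\<Sum>i\<le>Suc ?N. coeff (pCons 0 q) i * f (a ^ i * b))"
    unfolding apply_poly_altdef[OF deg] sum.distrib[symmetric]
    by (intro sum.cong) (auto simp: eq algebra_simps)
  also have "(\<Sum>i\<le>Suc ?N. - w * (coeff q i * f (a ^ i * b))) =
      (\<Sum>i\<le>?N. - w * (coeff q i * f (a ^ i * b)))"
    by (simp add: coeff_eq_0)
  also have "(\<Sum>i\<le>Suc ?N. coeff (pCons 0 q) i * f (a ^ i * b)) =
      (\<Sum>i\<le>?N. coeff q i * f (a * (a ^ i * b)))"
    by (subst sum.atMost_Suc_shift) (simp add: mult.assoc)
  finally show "apply_poly ([:-w, 1:] * q) a f b = apply_poly q a (\<lambda>b. f (a * b) - w * f b) b"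
    unfolding apply_poly_def sum.distrib[symmetric]
    by (simp add: algebra_simps sum_subtractf sum_negf)
qed

lemma apply_poly_eigen_shift:
  "apply_poly q a (\<lambda>b. f (a * b) - w * f b) b = apply_poly q a f (a * b) - w * apply_poly q a f b"
  unfolding apply_poly_def by (simp add: algebra_simps sum_subtractf sum_distrib_left)

lemma rat_linear_apply_poly: "rat_linear f \<Longrightarrow> rat_linear (apply_poly p a f)"
  unfolding rat_linear_def apply_poly_def
  by (simp add: distrib_left sum.distrib sum_distrib_left mult.left_commute)

lemma apply_poly_const:
  assumes "degree p = 0" and "p \<noteq> 0" and "apply_poly p a f = (\<lambda>_. 0)"
  shows "f = (\<lambda>_. 0)"
proof
  fix b
  have "coeff p 0 \<noteq> 0" using assms(1,2) leading_coeff_neq_0[of p] by simp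
  moreover have "coeff p 0 * f b = 0"
    using fun_cong[OF assms(3), of b] assms(1) by (simp add: apply_poly_def)
  ultimately show "f b = 0" by simp
qed

lemma obtain_linear_factor:
  fixes p :: "complex poly"
  assumes "degree p \<noteq> 0"
  obtains w q where "p = [:-w, 1:] * q" "degree p = Suc (degree q)" "q \<noteq> 0"
proof -
  obtain w where "poly p w = 0"
    using fundamental_theorem_of_algebra[of p] assms by (auto simp: constant_degree)
  then obtain q where q: "p = [:-w, 1:] * q"
    by (metis dvdE poly_eq_0_iff_dvd)
  moreover have "q \<noteq> 0" using q assms by auto
  moreover from this have "degree p = Suc (degree q)"
    unfolding q by (subst degree_mult_eq) auto
  ultimately show ?thesis using that by blast
qed

text \<open>Split \<open>p\<close> into linear factors and apply the operators \<open>T - w\<close>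
  to \<open>f\<close> one after another: the last nonzero functional is an eigenvector. The property
  \<open>Q\<close> is preserved by each of these operators, so eigenvector conditions for other
  elements can be carried along.\<close>

lemma eigenfunctional_exists:
  assumes "p \<noteq> 0" and "apply_poly p a f = (\<lambda>_. 0)"
    and "Q f" and "f \<noteq> (\<lambda>_. 0)"
    and closed: "\<And>w g. Q g \<Longrightarrow> Q (\<lambda>b. g (a * b) - w * g b)"
  shows "\<exists>g l. Q g \<and> g \<noteq> (\<lambda>_. 0) \<and> (\<forall>b. g (a * b) = l * g b)"
  using assms(1-4)
proof (induction "degree p" arbitrary: p f)
  case 0
  then show ?case using apply_poly_const[of p a f] by simp
next
  case (Suc n)
  obtain w q where q: "p = [:-w, 1:] * q" "degree p = Suc (degree q)" "q \<noteq> 0"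
    using Suc.hyps(2) by (metis obtain_linear_factor Zero_not_Suc)
  let ?g = "\<lambda>b. f (a * b) - w * f b"
  show ?case
  proof (cases "?g = (\<lambda>_. 0)")
    case True
    then have "\<forall>b. f (a * b) = w * f b" by (auto dest: fun_cong)
    then show ?thesis using Suc.prems by blast
  next
    case False
    have "apply_poly q a ?g = (\<lambda>_. 0)"
      using Suc.prems(2) unfolding q(1) apply_poly_linear_factor .
    then show ?thesis
      using Suc.hyps(1)[of q ?g] Suc.hyps(2) q False closed[OF Suc.prems(3)] by simp
  qed
qed

section \<open>Common eigenfunctionals over a number field\<close>

locale rat_algebra =
  finite_dimensional_vector_space "\<lambda>(r::rat) x. of_rat r * x" B
  for B :: "'k::field_char_0 set"
begin

text \<open>Either two powers of \<open>a\<close> coincide, or the powers form an infinite and hence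
  dependent set. The cases are separated because a dependence relation attaches coefficients to
  elements; only injectivity lets them be read as attached to exponents.\<close>

lemma rat_poly_root:
  fixes a :: 'k
  obtains p :: "rat poly" where "p \<noteq> 0" "poly (map_poly of_rat p) a = 0"
proof (cases "inj (\<lambda>i::nat. a ^ i)")
  case False
  then obtain i j :: nat where ij: "i \<noteq> j" "a ^ i = a ^ j" by (auto simp: inj_def)
  let ?p = "monom 1 i - monom 1 j :: rat poly"
  have "coeff ?p i \<noteq> 0" using ij by simp
  then have "?p \<noteq> 0" by (metis coeff_0)
  moreover have "map_poly of_rat ?p = (monom 1 i - monom 1 j :: 'k poly)"
    by (intro poly_eqI) (auto simp: coeff_map_poly of_rat_diff)
  ultimately show ?thesis using that[of ?p] ij by (simp add: poly_monom)
next
  case True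
  have "infinite (range (\<lambda>i::nat. a ^ i))"
    using True by (simp add: finite_image_iff)
  then have "dependent (range (\<lambda>i::nat. a ^ i))"
    using finiteI_independent by blast
  then obtain t u where t: "finite t" "t \<subseteq> range (\<lambda>i::nat. a ^ i)"
      "(\<Sum>v\<in>t. of_rat (u v) * v) = 0" "\<exists>v\<in>t. u v \<noteq> 0"
    unfolding dependent_explicit by blast
  obtain I where I: "t = (\<lambda>i::nat. a ^ i) ` I" using t(2) by (metis subset_imageE)
  have inj: "inj_on (\<lambda>i::nat. a ^ i) I" using True by (rule inj_on_subset) simp
  have fin: "finite I" using t(1) I inj by (simp add: finite_image_iff)
  let ?p = "\<Sum>i\<in>I. monom (u (a ^ i)) i"
  have coeff: "coeff ?p j = (if j \<in> I then u (a ^ j) else 0)" for j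
    using fin by (simp add: coeff_sum)
  have "?p \<noteq> 0"
    using t(4) coeff I by (auto simp: poly_eq_iff)
  moreover have "map_poly of_rat ?p = (\<Sum>i\<in>I. monom (of_rat (u (a ^ i))) i :: 'k poly)"
    using fin by (intro poly_eqI) (simp add: coeff_map_poly coeff_sum of_rat_sum if_distrib)
  then have "poly (map_poly of_rat ?p) a = (\<Sum>i\<in>I. of_rat (u (a ^ i)) * a ^ i)"
    by (simp add: poly_sum poly_monom)
  then have "poly (map_poly of_rat ?p) a = 0"
    using t(3) unfolding I by (simp add: sum.reindex[OF inj] o_def)
  ultimately show ?thesis using that by blast
qed

text \<open>A rational polynomial vanishing at \<open>a\<close> works for all \<open>f\<close> at
  once, since its coefficients can be moved inside a rational-linear functional.\<close>

lemma annihilating_poly: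
  fixes a :: 'k
  obtains p where "p \<noteq> 0" "\<And>f. rat_linear f \<Longrightarrow> apply_poly p a f = (\<lambda>_. 0)"
proof -
  obtain p :: "rat poly" where p: "p \<noteq> 0" "poly (map_poly of_rat p) a = 0"
    using rat_poly_root[of a] by blast
  let ?P = "map_poly of_rat p :: complex poly"
  have deg: "degree ?P = degree p" "degree (map_poly of_rat p :: 'k poly) = degree p"
    by (auto intro!: degree_map_poly)
  have "?P \<noteq> 0" using p(1) by (simp add: map_poly_eq_0_iff)
  moreover have "apply_poly ?P a f b = 0" if "rat_linear f" for f b
  proof -
    have "apply_poly ?P a f b = (\<Sum>i\<le>degree p. f (of_rat (coeff p i) * (a ^ i * b)))"
      using that by (simp add: apply_poly_def deg coeff_map_poly rat_linear_def)
    also have "\<dots> = f (\<Sum>i\<le>degree p. of_rat (coeff p i) * (a ^ i * b))"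
      by (simp add: rat_linear_sum[OF that])
    also have "(\<Sum>i\<le>degree p. of_rat (coeff p i) * (a ^ i * b)) = poly (map_poly of_rat p) a * b"
      by (simp add: poly_altdef deg coeff_map_poly sum_distrib_right mult.assoc)
    finally show ?thesis using p(2) rat_linear_0[OF that] by simp
  qed
  ultimately show ?thesis using that by blast
qed

text \<open>
  An eigenfunctional \<open>f\<close> for multiplication by \<open>d\<close> can be improved to a common eigenfunctional for
  multiplication by all basis elements, hence by all field elements; \<open>f / f 1\<close> is then an embedding.
\<close>

lemma eigenvalue_is_embedding_value:
  assumes "rat_linear f" and "f \<noteq> (\<lambda>_. 0)" and "\<And>b. f (d * b) = w * f b"
  shows "\<exists>\<sigma>\<in>embeddings. \<sigma> (d::'k) = w"
proof -
  \<comment> \<open>Induction over finite sets \<open>A\<close> of multipliers, keeping the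
    eigenvalue \<open>w\<close> of \<open>d\<close> fixed throughout.\<close>
  have "\<exists>g. rat_linear g \<and> g \<noteq> (\<lambda>_. 0) \<and> (\<forall>b. g (d * b) = w * g b) \<and>
      (\<forall>a\<in>A. \<exists>l. \<forall>b. g (a * b) = l * g b)" if "finite A" for A
    using that
  proof (induction A)
    case empty
    then show ?case using assms by auto
  next
    case (insert a A)
    define Q where "Q = (\<lambda>g. rat_linear g \<and> (\<forall>b. g (d * b) = w * g b) \<and>
        (\<forall>a\<in>A. \<exists>l. \<forall>b. g (a * b) = l * g b))"
    obtain g where g: "Q g" "g \<noteq> (\<lambda>_. 0)" using insert.IH by (auto simp: Q_def)
    obtain p where p: "p \<noteq> 0" "\<And>f. rat_linear f \<Longrightarrow> apply_poly p a f = (\<lambda>_. 0)"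
      using annihilating_poly[of a] by blast
    \<comment> \<open>Multiplications by field elements commute, so \<open>T - v\<close> for the new
      element \<open>a\<close> preserves the eigenspaces already secured.\<close>
    have "Q (\<lambda>b. h (a * b) - v * h b)" if "Q h" for v h
      unfolding Q_def
    proof (intro conjI allI ballI)
      show "rat_linear (\<lambda>b. h (a * b) - v * h b)"
        using that by (simp add: Q_def rat_linear_eigen_shift)
    next
      fix b
      have "h (a * (d * b)) = w * h (a * b)" "h (d * b) = w * h b"
        using that by (auto simp: Q_def mult.left_commute[of a d])
      then show "h (a * (d * b)) - v * h (d * b) = w * (h (a * b) - v * h b)"
        by (simp add: algebra_simps)
    next
      fix c assume "c \<in> A"
      then obtain l where l: "\<forall>b. h (c * b) = l * h b" using \<open>Q h\<close> unfolding Q_def by blast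
      have "h (a * (c * b)) - v * h (c * b) = l * (h (a * b) - v * h b)" for b
        by (simp add: l mult.left_commute[of a c]) (simp add: algebra_simps)
      then show "\<exists>l. \<forall>b. h (a * (c * b)) - v * h (c * b) = l * (h (a * b) - v * h b)" by blast
    qed
    then obtain h l where "Q h" "h \<noteq> (\<lambda>_. 0)" "\<forall>b. h (a * b) = l * h b"
      using eigenfunctional_exists[of p a g Q] p g by (auto simp: Q_def)
    then show ?case unfolding Q_def by blast
  qed
  from this[OF finite_Basis] obtain g where g: "rat_linear g" "g \<noteq> (\<lambda>_. 0)" "\<forall>b. g (d * b) = w * g b"
      "\<forall>a\<in>B. \<exists>l. \<forall>b. g (a * b) = l * g b" by blast
  \<comment> \<open>The elements acting on \<open>g\<close> by scalars form a rational subspace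
    containing the basis.\<close>
  have eig: "\<exists>l. \<forall>b. g (a * b) = l * g b" for a
  proof -
    have "a \<in> span B" using span_Basis by simp
    then show ?thesis
    proof (induction rule: span_induct_alt)
      case base
      then show ?case using rat_linear_0[OF g(1)] by (intro exI[of _ 0]) simp
    next
      case (step c x y)
      obtain l k where "\<forall>b. g (x * b) = l * g b" "\<forall>b. g (y * b) = k * g b"
        using step g(4) by blast
      then have "\<forall>b. g ((of_rat c * x + y) * b) = (of_rat c * l + k) * g b"
        using g(1) by (simp add: rat_linear_def distrib_right mult.assoc)
      then show ?case by blast
    qed
  qed
  have mult: "g (a * b) * g 1 = g a * g b" for a b
  proof -
    obtain l where l: "\<forall>b. g (a * b) = l * g b" using eig by blast
    have "g a = l * g 1" using l[rule_format, of 1] by simp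
    then show ?thesis using l by simp
  qed
  have "g 1 \<noteq> 0"
  proof
    assume "g 1 = 0"
    then have "g b = 0" for b using eig[of b] by (metis mult_zero_right mult.right_neutral)
    then show False using g(2) by auto
  qed
  then have "g (a * b) / g 1 = g a / g 1 * (g b / g 1)" for a b
    using mult[of a b] by (simp add: divide_simps)
  then have "(\<lambda>a. g a / g 1) \<in> embeddings"
    using g(1) \<open>g 1 \<noteq> 0\<close> by (simp add: embeddings_def rat_linear_def add_divide_distrib)
  moreover have "g d / g 1 = w" using g(3)[rule_format, of 1] \<open>g 1 \<noteq> 0\<close> by simp
  ultimately show ?thesis by (intro bexI[of _ "\<lambda>a. g a / g 1"])
qed

end

section \<open>Decay of the powers of an element with small conjugates\<close>

lemma affine_recurrence_tendsto_0:
  fixes s t :: "nat \<Rightarrow> complex"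
  assumes rec: "\<And>n. s (Suc n) = w * s n + t n" and w: "cmod w < 1" and t: "t \<longlonglongrightarrow> 0"
  shows "s \<longlonglongrightarrow> 0"
proof (rule LIMSEQ_I)
  fix e :: real assume e: "e > 0"
  define r where "r = cmod w"
  have r: "0 \<le> r" "r < 1" using w by (auto simp: r_def)
  \<comment> \<open>The tolerance for \<open>t\<close> is chosen so that \<open>e / 2\<close> is the
    fixed point of \<open>c\<close> going to \<open>r * c + e * (1 - r) / 2\<close>; the bound below
    then reproduces itself.\<close>
  have "e * (1 - r) / 2 > 0" using e r by simp
  then obtain N where N: "\<And>n. n \<ge> N \<Longrightarrow> cmod (t n) < e * (1 - r) / 2"
    using LIMSEQ_D[OF t, of "e * (1 - r) / 2"] by auto
  have bound: "cmod (s (N + k)) \<le> r ^ k * cmod (s N) + e / 2" for k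
  proof (induction k)
    case 0
    then show ?case using e by simp
  next
    case (Suc k)
    have "cmod (s (N + Suc k)) \<le> r * cmod (s (N + k)) + cmod (t (N + k))"
      using norm_triangle_ineq[of "w * s (N + k)" "t (N + k)"]
      by (simp add: rec r_def norm_mult)
    also have "\<dots> \<le> r * (r ^ k * cmod (s N) + e / 2) + e * (1 - r) / 2"
      using N[of "N + k"] Suc.IH r by (intro add_mono mult_left_mono) auto
    also have "\<dots> = r ^ Suc k * cmod (s N) + e / 2" by (simp add: field_simps)
    finally show ?case .
  qed
  have "(\<lambda>k. r ^ k * cmod (s N)) \<longlonglongrightarrow> 0"
    using r by (intro tendsto_mult_left_zero LIMSEQ_power_zero) auto
  then obtain M where M: "\<And>k. k \<ge> M \<Longrightarrow> r ^ k * cmod (s N) < e / 2"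
    using order_tendstoD(2)[of _ 0 sequentially "e / 2"] e
    by (auto simp: eventually_sequentially)
  have "norm (s n - 0) < e" if "n \<ge> N + M" for n
    using bound[of "n - N"] M[of "n - N"] that by fastforce
  then show "\<exists>n0. \<forall>n\<ge>n0. norm (s n - 0) < e" by blast
qed

text \<open>Induction on the degree of an annihilator \<open>p = (X - w) q\<close>. If
  \<open>|w| < 1\<close>, then \<open>(T - w) f\<close> decays along the powers by induction, and
  \<open>f\<close> follows by an affine recurrence. If \<open>|w| \<ge> 1\<close>, then
  \<open>w\<close> is no embedding value of \<open>d\<close>, so it is no eigenvalue; this forces
  \<open>q(T) f = 0\<close>, and \<open>q\<close> is a shorter annihilator.\<close>

lemma (in rat_algebra) rat_linear_powers_tendsto_0:
  fixes d :: 'k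
  assumes small: "\<And>\<sigma>. \<sigma> \<in> embeddings \<Longrightarrow> cmod (\<sigma> d) < 1" and "rat_linear f"
  shows "(\<lambda>n. f (d ^ n * b)) \<longlonglongrightarrow> 0"
proof -
  have "(\<lambda>n. f (d ^ n * b)) \<longlonglongrightarrow> 0"
    if "p \<noteq> 0" "apply_poly p d f = (\<lambda>_. 0)" "rat_linear f" for p f b
    using that
  proof (induction "degree p" arbitrary: p f b)
    case 0
    then have "f = (\<lambda>_. 0)" using apply_poly_const[of p d f] by simp
    then show ?case by simp
  next
    case (Suc n)
    obtain w q where q: "p = [:-w, 1:] * q" "degree p = Suc (degree q)" "q \<noteq> 0"
      using Suc.hyps(2) by (metis obtain_linear_factor Zero_not_Suc)
    let ?g = "\<lambda>b. f (d * b) - w * f b"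
    have ann: "apply_poly q d ?g = (\<lambda>_. 0)"
      using Suc.prems(2) unfolding q(1) apply_poly_linear_factor .
    show ?case
    proof (cases "cmod w < 1")
      case True
      have "(\<lambda>n. ?g (d ^ n * b)) \<longlonglongrightarrow> 0"
        using Suc.hyps(1)[of q ?g] Suc.hyps(2) q ann rat_linear_eigen_shift[OF Suc.prems(3)] by simp
      then show ?thesis
        by (rule affine_recurrence_tendsto_0[OF _ True, rotated]) (simp add: mult.assoc)
    next
      case False
      have "apply_poly q d f (d * b) = w * apply_poly q d f b" for b
        using fun_cong[OF ann, of b] by (simp add: apply_poly_eigen_shift)
      then have "apply_poly q d f = (\<lambda>_. 0)"
        using eigenvalue_is_embedding_value[OF rat_linear_apply_poly[OF Suc.prems(3)]] small False
        by blast
      then show ?thesis using Suc.hyps(1)[of q f] Suc.hyps(2) q Suc.prems(3) by simp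
    qed
  qed
  moreover obtain p where "p \<noteq> 0" "\<And>f. rat_linear f \<Longrightarrow> apply_poly p d f = (\<lambda>_. 0)"
    using annihilating_poly[of d] by blast
  ultimately show ?thesis using assms(2) by blast
qed

section \<open>Algebraic integers with small conjugates\<close>

text \<open>The monic relation expresses a high power of \<open>x\<close> through lower ones with
  integer coefficients. The extra factor \<open>m\<close> allows a second use with another integral
  element.\<close>

lemma power_mult_mem_of_monic_root:
  fixes x m :: "'a::field_char_0"
  assumes p: "lead_coeff p = 1" "\<forall>i. coeff p i \<in> \<int>" "poly p x = 0"
    and zero: "0 \<in> M" and add: "\<And>u v. u \<in> M \<Longrightarrow> v \<in> M \<Longrightarrow> u + v \<in> M"
    and scale: "\<And>k v. v \<in> M \<Longrightarrow> of_int k * v \<in> M"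
    and base: "\<And>i. i < degree p \<Longrightarrow> x ^ i * m \<in> M"
  shows "x ^ i * m \<in> M"
proof (induction i rule: less_induct)
  case (less i)
  show ?case
  proof (cases "i < degree p")
    case False
    define D where "D = degree p"
    have sum_mem: "(\<Sum>j\<in>J. g j) \<in> M" if "finite J" "\<And>j. j \<in> J \<Longrightarrow> g j \<in> M" for g and J :: "nat set"
      using that by (induction J) (auto simp: zero add)
    have "0 = (\<Sum>j<D. coeff p j * x ^ j) + x ^ D"
      using p(1,3) by (simp add: poly_altdef D_def lessThan_Suc_atMost[symmetric])
    then have "x ^ D = of_int (-1) * (\<Sum>j<D. coeff p j * x ^ j)"
      by (simp add: eq_neg_iff_add_eq_0 add.commute)
    moreover have "x ^ i = x ^ (i - D) * x ^ D"
      using False by (simp add: D_def flip: power_add)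
    ultimately have "x ^ i * m = of_int (-1) * (\<Sum>j<D. coeff p j * (x ^ (i - D + j) * m))"
      by (simp add: sum_distrib_left sum_distrib_right power_add mult_ac)
    also have "\<dots> \<in> M"
    proof (intro scale sum_mem)
      fix j assume "j \<in> {..<D}"
      then have "x ^ (i - D + j) * m \<in> M" using False by (intro less) (auto simp: D_def)
      moreover obtain k where "coeff p j = of_int k" using p(2) by (metis Ints_cases)
      ultimately show "coeff p j * (x ^ (i - D + j) * m) \<in> M" using scale by simp
    qed simp
    finally show ?thesis .
  qed (use base in blast)
qed

text \<open>The relations make \<open>y\<close> an eigenvalue of an integer matrix, hence a root of
  its characteristic polynomial, which is monic with integer coefficients.\<close>

lemma algebraic_int_of_integer_matrix:
  fixes y :: "'a::field_char_0" and v :: "nat \<Rightarrow> 'a" and A :: "nat \<Rightarrow> nat \<Rightarrow> int"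
  assumes v: "i0 < d" "v i0 \<noteq> 0"
    and A: "\<And>i. i < d \<Longrightarrow> y * v i = (\<Sum>j<d. of_int (A i j) * v j)"
  shows "algebraic_int y"
proof -
  define M where "M = mat d d (\<lambda>(i, j). A i j)"
  have M: "M \<in> carrier_mat d d" by (simp add: M_def)
  let ?M = "map_mat of_int M :: 'a mat"
  have "eigenvector ?M (vec d v) y"
    unfolding eigenvector_def
  proof (intro conjI)
    show "vec d v \<noteq> 0\<^sub>v (dim_row ?M)"
      using v by (auto simp: M_def vec_eq_iff)
    show "?M *\<^sub>v vec d v = y \<cdot>\<^sub>v vec d v"
      by (intro eq_vecI) (auto simp: M_def scalar_prod_def A atLeast0LessThan)
  qed (simp add: M_def)
  then have "eigenvalue ?M y" by (auto simp: eigenvalue_def)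
  then have "poly (char_poly ?M) y = 0"
    using eigenvalue_root_char_poly[of ?M d] M by simp
  then have "poly (map_poly of_int (char_poly M)) y = 0"
    by (simp add: of_int_hom.char_poly_hom[OF M])
  moreover have "lead_coeff (char_poly M) = 1"
    using degree_monic_char_poly[OF M] by simp
  ultimately show ?thesis by (auto simp: algebraic_int_altdef_ipoly)
qed

text \<open>All powers of \<open>x\<close> are integer combinations of those below the degree
  \<open>d\<close>, so multiplication by \<open>x ^ n\<close> acts on these \<open>d\<close> powers
  by an integer matrix.\<close>

lemma algebraic_int_power:
  fixes x :: "'a::field_char_0"
  assumes "algebraic_int x"
  shows "algebraic_int (x ^ n)"
proof -
  obtain p where p: "lead_coeff p = 1" "\<forall>i. coeff p i \<in> \<int>" "poly p x = 0"
    using assms by (rule algebraic_int.cases) blast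
  define d where "d = degree p"
  define M where "M = range (\<lambda>c. \<Sum>j<d. of_int (c j) * x ^ j)"
  have "x ^ i * 1 \<in> M" for i
  proof (rule power_mult_mem_of_monic_root[OF p])
    show "0 \<in> M" unfolding M_def by (rule range_eqI[of _ _ "\<lambda>_. 0"]) simp
  next
    fix u v assume "u \<in> M" "v \<in> M"
    then obtain a b where "u = (\<Sum>j<d. of_int (a j) * x ^ j)" "v = (\<Sum>j<d. of_int (b j) * x ^ j)"
      by (auto simp: M_def)
    then show "u + v \<in> M" unfolding M_def
      by (intro range_eqI[of _ _ "\<lambda>j. a j + b j"]) (simp add: sum.distrib distrib_right)
  next
    fix k v assume "v \<in> M"
    then obtain a where "v = (\<Sum>j<d. of_int (a j) * x ^ j)" by (auto simp: M_def)
    then show "of_int k * v \<in> M" unfolding M_def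
      by (intro range_eqI[of _ _ "\<lambda>j. k * a j"]) (simp add: sum_distrib_left mult.assoc)
  next
    fix i assume "i < degree p"
    then have "x ^ i * 1 = (\<Sum>j<d. of_int (if j = i then 1 else 0) * x ^ j)"
      by (simp add: d_def if_distrib if_distribR sum.delta cong: if_cong)
    then show "x ^ i * 1 \<in> M"
      unfolding M_def by (rule range_eqI[of _ _ "\<lambda>j. if j = i then 1 else 0"])
  qed
  then have "\<forall>i. \<exists>c. x ^ i = (\<Sum>j<d. of_int (c j) * x ^ j)" by (auto simp: M_def)
  then obtain c where c: "\<And>i. x ^ i = (\<Sum>j<d. of_int (c i j) * x ^ j)" by metis
  \<comment> \<open>The eigenvector must be nonzero: its entry at index 0 is
    \<open>x ^ 0 = 1\<close>, which exists only if \<open>d > 0\<close>.\<close>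
  have "d > 0"
  proof (rule ccontr)
    assume "\<not> d > 0"
    then have "p = 1" using p(1) by (auto simp: d_def one_pCons elim!: degree_eq_zeroE)
    then show False using p(3) by simp
  qed
  then show ?thesis
    by (rule algebraic_int_of_integer_matrix[where v = "\<lambda>j. x ^ j" and A = "\<lambda>i. c (n + i)"])
      (simp_all add: c[symmetric] power_add[symmetric])
qed

section \<open>Bounded denominators and vanishing of small algebraic integers\<close>

lemma common_denominator:
  fixes S :: "'a::field_char_0 set"
  assumes "finite S" and "S \<subseteq> \<rat>"
  shows "\<exists>N::int. N > 0 \<and> (\<forall>s\<in>S. of_int N * s \<in> \<int>)"
  using assms
proof (induction S)
  case (insert s S)
  then obtain N :: int where N: "N > 0" "\<forall>s\<in>S. of_int N * s \<in> \<int>" by auto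
  obtain a b :: int where ab: "b > 0" "s = of_int a / of_int b"
    using insert.prems by (auto elim: Rats_cases')
  have "of_int (N * b) * t \<in> \<int>" if "t \<in> insert s S" for t
  proof (cases "t = s")
    case True
    then have "of_int (N * b) * t = of_int (N * a)" using ab by simp
    then show ?thesis by (metis Ints_of_int)
  next
    case False
    then have "of_int b * (of_int N * t) \<in> \<int>" using that N by (intro Ints_mult[of "of_int b"]) auto
    then show ?thesis by (simp add: mult_ac)
  qed
  then show ?case using N(1) ab(1) by (intro exI[of _ "N * b"]) auto
qed (auto intro: exI[of _ 1])

lemma rat_linear_bounded_denominators:
  fixes x y :: "'k::field_char_0"
  assumes "algebraic_int x" and "algebraic_int y" and f: "rat_linear f" "range f \<subseteq> \<rat>"
  shows "\<exists>N::int. N > 0 \<and> (\<forall>n. of_int N * f ((x - y) ^ n) \<in> \<int>)"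
proof -
  obtain p where p: "lead_coeff p = 1" "\<forall>i. coeff p i \<in> \<int>" "poly p x = 0"
    using assms(1) by (auto elim: algebraic_int.cases)
  have "algebraic_int (- y)" using assms(2) by (rule algebraic_int_minus)
  then obtain q where q: "lead_coeff q = 1" "\<forall>i. coeff q i \<in> \<int>" "poly q (- y) = 0"
    by (rule algebraic_int.cases) blast
  let ?S = "(\<lambda>(i, j). f (x ^ i * (- y) ^ j)) ` ({..<degree p} \<times> {..<degree q})"
  obtain N :: int where N: "N > 0" "\<forall>s\<in>?S. of_int N * s \<in> \<int>"
    using common_denominator[of ?S] f(2) by (metis (no_types, lifting) finite_SigmaI finite_imageI
        finite_lessThan image_subset_iff range_subsetD split_beta)
  define M where "M = {v. of_int N * f v \<in> \<int>}"
  have zero: "0 \<in> M" by (simp add: M_def rat_linear_0[OF f(1)])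
  have add: "u + v \<in> M" if "u \<in> M" "v \<in> M" for u v
    using that f(1) by (simp add: M_def rat_linear_def distrib_left)
  have scale: "of_int k * v \<in> M" if "v \<in> M" for k v
  proof -
    have "of_int k * (of_int N * f v) \<in> \<int>"
      using that by (intro Ints_mult[of "of_int k"]) (auto simp: M_def)
    then show ?thesis by (simp add: M_def rat_linear_of_int[OF f(1)] mult.left_commute)
  qed
  \<comment> \<open>The exponent of \<open>x\<close> is freed first, with the power of
    \<open>-y\<close> as the fixed factor; afterwards the roles are exchanged.\<close>
  have "x ^ i * (- y) ^ j \<in> M" if "j < degree q" for i j
    using p zero add scale
  proof (rule power_mult_mem_of_monic_root)
    show "x ^ i * (- y) ^ j \<in> M" if "i < degree p" for i
      using N(2) that \<open>j < degree q\<close> by (auto simp: M_def)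
  qed
  then have "(- y) ^ j * x ^ i \<in> M" if "j < degree q" for i j
    using that by (metis mult.commute)
  then have mono: "(- y) ^ j * x ^ i \<in> M" for i j
    using power_mult_mem_of_monic_root[OF q zero add scale] by blast
  have sum_mem: "(\<Sum>j\<in>J. g j) \<in> M" if "finite J" "\<And>j. j \<in> J \<Longrightarrow> g j \<in> M" for g and J :: "nat set"
    using that by (induction J) (auto simp: zero add)
  have "(x - y) ^ n \<in> M" for n
  proof -
    have "(x - y) ^ n = (\<Sum>k\<le>n. of_int (int (n choose k)) * ((- y) ^ (n - k) * x ^ k))"
      using binomial_ring[of x "- y" n] by (simp add: mult.assoc mult.commute[of "x ^ _"])
    also have "\<dots> \<in> M" by (intro sum_mem scale mono) simp
    finally show ?thesis .
  qed
  then show ?thesis using N(1) by (auto simp: M_def)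
qed

lemma (in rat_algebra) algebraic_int_eqI:
  fixes x y :: 'k
  assumes "algebraic_int x" and "algebraic_int y"
    and small: "\<And>\<sigma>. \<sigma> \<in> embeddings \<Longrightarrow> cmod (\<sigma> (x - y)) < 1"
  shows "x = y"
proof -
  \<comment> \<open>The coordinate functionals of the basis, made complex-valued so that the decay
    result applies.\<close>
  define f :: "'k \<Rightarrow> 'k \<Rightarrow> complex" where "f b v = of_rat (representation B v b)" for b v
  have lin: "rat_linear (f b)" for b
    by (simp add: rat_linear_def f_def representation_add representation_scale independent_Basis
        span_Basis of_rat_add of_rat_mult)
  have "\<forall>\<^sub>F n in sequentially. f b ((x - y) ^ n) = 0" for b
  proof -
    have "range (f b) \<subseteq> \<rat>" by (auto simp: f_def)
    then obtain N :: int where N: "N > 0" "\<And>n. of_int N * f b ((x - y) ^ n) \<in> \<int>"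
      using rat_linear_bounded_denominators[OF assms(1,2) lin[of b]] by blast
    have "(\<lambda>n. f b ((x - y) ^ n * 1)) \<longlonglongrightarrow> 0"
      by (rule rat_linear_powers_tendsto_0[OF small lin])
    then have "(\<lambda>n. of_int N * f b ((x - y) ^ n)) \<longlonglongrightarrow> 0"
      by (intro tendsto_mult_right_zero) simp
    then have "\<forall>\<^sub>F n in sequentially. cmod (of_int N * f b ((x - y) ^ n)) < 1"
      using tendsto_norm_zero order_tendstoD(2)[of _ 0 sequentially 1] by fastforce
    then show ?thesis
    proof eventually_elim
      case (elim n)
      obtain k where k: "of_int N * f b ((x - y) ^ n) = of_int k" using N(2) by (metis Ints_cases)
      then have "k = 0" using elim by simp
      then show ?case using k N(1) by simp
    qed
  qed
  then have "\<forall>\<^sub>F n in sequentially. \<forall>b\<in>B. f b ((x - y) ^ n) = 0"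
    by (intro eventually_ball_finite finite_Basis) blast
  then obtain n where n: "\<forall>b\<in>B. f b ((x - y) ^ n) = 0"
    using eventually_happens'[OF sequentially_bot] by blast
  have "(x - y) ^ n = (\<Sum>b\<in>B. of_rat (representation B ((x - y) ^ n) b) * b)"
    by (rule sum_representation_eq[symmetric]) (simp_all add: independent_Basis span_Basis finite_Basis)
  also have "\<dots> = 0" using n by (simp add: f_def)
  finally show ?thesis by simp
qed

section \<open>Ultrapowers and growth classes\<close>

lemma mem_star_class: "g \<in> star_class U f \<longleftrightarrow> (\<forall>\<^sub>F n in U. f n = g n)"
  by (simp add: star_class_def ultra_rel_def)

lemma star_class_eq_iff: "star_class U f = star_class U g \<longleftrightarrow> (\<forall>\<^sub>F n in U. f n = g n)"
proof
  assume "star_class U f = star_class U g"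
  moreover have "g \<in> star_class U g" by (simp add: mem_star_class)
  ultimately have "g \<in> star_class U f" by simp
  then show "\<forall>\<^sub>F n in U. f n = g n" by (simp add: mem_star_class)
next
  assume fg: "\<forall>\<^sub>F n in U. f n = g n"
  show "star_class U f = star_class U g"
  proof (intro Set.set_eqI iffI)
    fix h assume "h \<in> star_class U f"
    then have "\<forall>\<^sub>F n in U. f n = h n" by (simp add: mem_star_class)
    with fg have "\<forall>\<^sub>F n in U. g n = h n" by eventually_elim simp
    then show "h \<in> star_class U g" by (simp add: mem_star_class)
  next
    fix h assume "h \<in> star_class U g"
    then have "\<forall>\<^sub>F n in U. g n = h n" by (simp add: mem_star_class)
    with fg have "\<forall>\<^sub>F n in U. f n = h n" by eventually_elim simp
    then show "h \<in> star_class U f" by (simp add: mem_star_class)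
  qed
qed

text \<open>With the next two lemmas, operations and relations on ultrapowers are computed on
  representatives.\<close>

lemma star_map_class: "star_map U h (star_class U f) = star_class U (\<lambda>n. h (f n))"
proof (intro Set.set_eqI iffI)
  fix g assume "g \<in> star_map U h (star_class U f)"
  then obtain f' where "\<forall>\<^sub>F n in U. f n = f' n" "\<forall>\<^sub>F n in U. g n = h (f' n)"
    by (auto simp: star_map_def mem_star_class)
  then have "\<forall>\<^sub>F n in U. h (f n) = g n" by eventually_elim simp
  then show "g \<in> star_class U (\<lambda>n. h (f n))" by (simp add: mem_star_class)
next
  fix g assume "g \<in> star_class U (\<lambda>n. h (f n))"
  then show "g \<in> star_map U h (star_class U f)"
    unfolding star_map_def by (auto simp: mem_star_class eq_commute intro!: bexI[of _ f])
qed

lemma star_map2_class: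
  "star_map2 U h (star_class U f) (star_class U g) = star_class U (\<lambda>n. h (f n) (g n))"
proof (intro Set.set_eqI iffI)
  fix k assume "k \<in> star_map2 U h (star_class U f) (star_class U g)"
  then obtain f' g' where "\<forall>\<^sub>F n in U. f n = f' n" "\<forall>\<^sub>F n in U. g n = g' n"
      "\<forall>\<^sub>F n in U. k n = h (f' n) (g' n)"
    by (auto simp: star_map2_def mem_star_class)
  then have "\<forall>\<^sub>F n in U. h (f n) (g n) = k n" by eventually_elim simp
  then show "k \<in> star_class U (\<lambda>n. h (f n) (g n))" by (simp add: mem_star_class)
next
  fix k assume "k \<in> star_class U (\<lambda>n. h (f n) (g n))"
  then show "k \<in> star_map2 U h (star_class U f) (star_class U g)"
    unfolding star_map2_def
    by (auto simp: mem_star_class eq_commute intro!: bexI[of _ f] bexI[of _ g])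
qed

lemma star_rel_class:
  "star_rel U R (star_class U f) (star_class U g) \<longleftrightarrow> (\<forall>\<^sub>F n in U. R (f n) (g n))"
proof
  assume "star_rel U R (star_class U f) (star_class U g)"
  then obtain f' g' where "\<forall>\<^sub>F n in U. f n = f' n" "\<forall>\<^sub>F n in U. g n = g' n"
      "\<forall>\<^sub>F n in U. R (f' n) (g' n)"
    by (auto simp: star_rel_def mem_star_class)
  then show "\<forall>\<^sub>F n in U. R (f n) (g n)" by eventually_elim simp
qed (auto simp: star_rel_def mem_star_class intro!: bexI[of _ f] bexI[of _ g])

text \<open>Turns infinitesimality into convergence along the ultrafilter, so that the calculus of
  limits applies.\<close>

lemma infinitesimal_class: "infinitesimal U (star_class U f) \<longleftrightarrow> (f \<longlongrightarrow> 0) U"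
  by (simp add: infinitesimal_def star_map_class star_of_def star_rel_class tendsto_iff)

text \<open>An ultrafilter containing a singleton is principal, so \<open>U\<close> avoids each
  single index and thus every finite initial segment. Ordinary limits of sequences are therefore
  limits along \<open>U\<close>.\<close>

lemma nonprincipal_le_sequentially:
  assumes U: "nonprincipal_ultrafilter U"
  shows "U \<le> sequentially"
proof -
  have bot: "U \<noteq> bot" and ultra: "\<And>P. eventually P U \<or> eventually (\<lambda>n. \<not> P n) U"
    and np: "\<And>n. U \<noteq> principal {n}"
    using U by (auto simp: nonprincipal_ultrafilter_def)
  have neq: "\<forall>\<^sub>F n in U. n \<noteq> k" for k
  proof (rule ccontr)
    assume "\<not> ?thesis"
    then have ev: "\<forall>\<^sub>F n in U. n = k" using ultra[of "\<lambda>n. n = k"] by auto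
    have "U = principal {k}"
    proof (rule antisym)
      show "U \<le> principal {k}" using ev by (simp add: le_principal)
      show "principal {k} \<le> U"
      proof (rule filter_leI)
        fix P assume "eventually P U"
        with ev have "\<forall>\<^sub>F n in U. P k" by eventually_elim simp
        then show "eventually P (principal {k})" using bot by (simp add: eventually_principal)
      qed
    qed
    then show False using np by blast
  qed
  have "\<forall>\<^sub>F n in U. N \<le> n" for N
  proof -
    have "\<forall>\<^sub>F n in U. \<forall>k\<in>{..<N}. n \<noteq> k" using neq by (intro eventually_ball_finite) auto
    then show ?thesis by eventually_elim (auto simp: not_less[symmetric])
  qed
  then have "filterlim (\<lambda>n. n) sequentially U" by (simp add: filterlim_at_top)
  then show ?thesis by (simp add: filterlim_def)
qed

section \<open>The group of finite units and products of its orbits\<close>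

lemma fin_units_pos_class:
  "star_class U f \<in> fin_units_pos U \<longleftrightarrow>
    (\<forall>\<^sub>F n in U. 0 < f n) \<and> (\<exists>C. \<forall>\<^sub>F n in U. \<bar>f n\<bar> \<le> C) \<and> \<not> (f \<longlongrightarrow> 0) U"
  by (auto simp: fin_units_pos_def star_def bounded_star_def star_map_class star_of_def
      star_rel_class infinitesimal_class)

lemma fin_units_pos_cases:
  assumes "u \<in> fin_units_pos U"
  obtains f where "u = star_class U f"
  using assms by (auto simp: fin_units_pos_def star_def)

lemma star_one_fin_units_pos: "U \<noteq> bot \<Longrightarrow> star_class U (\<lambda>_. 1) \<in> fin_units_pos U"
  by (auto simp: fin_units_pos_class tendsto_const_iff intro: exI[of _ 1])

lemma fin_units_pos_mult:
  assumes U: "nonprincipal_ultrafilter U"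
    and f: "star_class U f \<in> fin_units_pos U" and g: "star_class U g \<in> fin_units_pos U"
  shows "star_class U (\<lambda>n. f n * g n) \<in> fin_units_pos U"
proof -
  \<comment> \<open>Failure to converge to 0 only says that some bound fails to hold eventually; the
    ultrafilter property upgrades this to an eventual lower bound.\<close>
  have away: "\<exists>r>0. \<forall>\<^sub>F n in U. r \<le> \<bar>h n\<bar>" if "\<not> (h \<longlongrightarrow> 0) U" for h :: "nat \<Rightarrow> real"
  proof -
    obtain r where r: "r > 0" "\<not> (\<forall>\<^sub>F n in U. \<bar>h n\<bar> < r)"
      using \<open>\<not> (h \<longlongrightarrow> 0) U\<close> by (auto simp: tendsto_iff)
    then have "\<forall>\<^sub>F n in U. \<not> \<bar>h n\<bar> < r"
      using U unfolding nonprincipal_ultrafilter_def by blast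
    then show ?thesis using r(1) by (auto simp: not_less)
  qed
  obtain C D where C: "\<forall>\<^sub>F n in U. \<bar>f n\<bar> \<le> C" and D: "\<forall>\<^sub>F n in U. \<bar>g n\<bar> \<le> D"
    using f g by (auto simp: fin_units_pos_class)
  from C D have bdd: "\<forall>\<^sub>F n in U. \<bar>f n * g n\<bar> \<le> C * D"
    by eventually_elim (auto simp: abs_mult intro: mult_mono)
  obtain r s where r: "r > 0" "\<forall>\<^sub>F n in U. r \<le> \<bar>f n\<bar>" and s: "s > 0" "\<forall>\<^sub>F n in U. s \<le> \<bar>g n\<bar>"
    using f g away by (meson fin_units_pos_class)
  have "\<not> ((\<lambda>n. f n * g n) \<longlongrightarrow> 0) U"
  proof
    assume "((\<lambda>n. f n * g n) \<longlongrightarrow> 0) U"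
    then have "\<forall>\<^sub>F n in U. \<bar>f n * g n\<bar> < r * s"
      using r(1) s(1) by (auto simp: tendsto_iff)
    with r(2) s(2) have "\<forall>\<^sub>F n in U. False"
    proof eventually_elim
      case (elim n)
      then have "r * s \<le> \<bar>f n * g n\<bar>"
        unfolding abs_mult using r(1) s(1) by (intro mult_mono) auto
      then show ?case using elim by simp
    qed
    then show False using U by (simp add: nonprincipal_ultrafilter_def)
  qed
  moreover have "\<forall>\<^sub>F n in U. 0 < f n" "\<forall>\<^sub>F n in U. 0 < g n"
    using f g by (auto simp: fin_units_pos_class)
  then have "\<forall>\<^sub>F n in U. 0 < f n * g n" by eventually_elim simp
  ultimately show ?thesis using bdd by (auto simp: fin_units_pos_class)
qed

text \<open>Classes are orbits and their product is the elementwise one. One inclusion multiplies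
  the two units; the other puts the whole unit on the first factor and 1 on the second.\<close>

lemma growth_mult_class:
  assumes U: "nonprincipal_ultrafilter U"
  shows "growth_mult U (growth_class U (star_class U x)) (growth_class U (star_class U y)) =
    growth_class U (star_class U (\<lambda>n. x n * y n))"
proof (intro Set.set_eqI iffI)
  fix v assume "v \<in> growth_mult U (growth_class U (star_class U x)) (growth_class U (star_class U y))"
  then obtain a b where ab: "a \<in> fin_units_pos U" "b \<in> fin_units_pos U"
      "v = star_map2 U (*) (star_map2 U (*) a (star_class U x)) (star_map2 U (*) b (star_class U y))"
    by (auto simp: growth_mult_def growth_class_def)
  obtain f g where fg: "a = star_class U f" "b = star_class U g"
    using ab(1,2) by (meson fin_units_pos_cases)
  have "v = star_map2 U (*) (star_class U (\<lambda>n. f n * g n)) (star_class U (\<lambda>n. x n * y n))"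
    by (simp add: ab(3) fg star_map2_class mult_ac)
  then show "v \<in> growth_class U (star_class U (\<lambda>n. x n * y n))"
    using fin_units_pos_mult[OF U] ab(1,2) fg by (auto simp: growth_class_def)
next
  fix v assume "v \<in> growth_class U (star_class U (\<lambda>n. x n * y n))"
  then obtain a where a: "a \<in> fin_units_pos U"
      "v = star_map2 U (*) a (star_class U (\<lambda>n. x n * y n))"
    by (auto simp: growth_class_def)
  obtain f where f: "a = star_class U f" using a(1) by (rule fin_units_pos_cases)
  let ?one = "star_class U (\<lambda>_. 1 :: real)"
  have "v = star_map2 U (*) (star_map2 U (*) a (star_class U x)) (star_map2 U (*) ?one (star_class U y))"
    by (simp add: a(2) f star_map2_class mult_ac)
  moreover have "?one \<in> fin_units_pos U"
    using U by (intro star_one_fin_units_pos) (simp add: nonprincipal_ultrafilter_def)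
  ultimately show "v \<in> growth_mult U (growth_class U (star_class U x)) (growth_class U (star_class U y))"
    using a(1) by (auto simp: growth_mult_def growth_class_def)
qed

lemma growth_le_refl:
  assumes "U \<noteq> bot"
  shows "growth_le U (growth_class U (star_class U x)) (growth_class U (star_class U x))"
proof -
  have "star_class U x \<in> growth_class U (star_class U x)"
    unfolding growth_class_def using star_one_fin_units_pos[OF assms]
    by (force simp: star_map2_class image_iff)
  then show ?thesis
    by (auto simp: growth_le_def star_rel_class intro!: bexI[of _ "star_class U x"])
qed

section \<open>Minkowski space\<close>

lemma mink_class_class:
  "mink_class U (star_class U z) = (\<lambda>\<sigma>\<in>embeddings. growth_class U (star_class U (\<lambda>n. cmod (z n \<sigma>))))"
  by (simp add: mink_class_def abs_class_def star_coord_def star_map_class)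

lemma mink_growth_mult_class:
  assumes "nonprincipal_ultrafilter U"
  shows "mink_growth_mult U (mink_class U (star_class U z)) (mink_class U (star_class U w)) =
    mink_class U (star_class U (\<lambda>n. mink_mult (z n) (w n)))"
  unfolding mink_growth_mult_def mink_class_class
  by (rule restrict_ext) (simp add: growth_mult_class[OF assms] mink_mult_def norm_mult)

lemma mink_growth_le_refl:
  assumes "U \<noteq> bot"
  shows "mink_growth_le U (mink_class U (star_class U z)) (mink_class U (star_class U z))"
  by (simp add: mink_growth_le_def mink_class_class growth_le_refl[OF assms])

lemma star_class_mink_epsI:
  assumes "\<And>n. z n \<in> minkowski_space"
    and "\<And>\<sigma>. \<sigma> \<in> embeddings \<Longrightarrow> ((\<lambda>n. z n \<sigma>) \<longlongrightarrow> 0) U"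
  shows "star_class U z \<in> mink_eps U"
  using assms by (auto simp: mink_eps_def star_def star_coord_def star_map_class infinitesimal_class)

lemma star_class_mink_epsD:
  assumes "star_class U z \<in> mink_eps U" and "\<sigma> \<in> embeddings"
  shows "((\<lambda>n. z n \<sigma>) \<longlongrightarrow> 0) U"
  using assms by (simp add: mink_eps_def star_coord_def star_map_class infinitesimal_class)

lemma cnj_embedding: "\<sigma> \<in> embeddings \<Longrightarrow> (\<lambda>x. cnj (\<sigma> x)) \<in> embeddings"
  by (simp add: embeddings_def)

lemma mink_embed_mem: "mink_embed a \<in> minkowski_space"
  by (auto simp: minkowski_space_def mink_embed_def cnj_embedding)

lemma mink_diag_mem: "mink_diag t \<in> minkowski_space"
  by (auto simp: minkowski_space_def mink_diag_def cnj_embedding)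

lemma mink_mult_mem:
  "z \<in> minkowski_space \<Longrightarrow> w \<in> minkowski_space \<Longrightarrow> mink_mult z w \<in> minkowski_space"
  by (auto simp: minkowski_space_def mink_mult_def cnj_embedding)

lemma mink_diff_mem:
  "z \<in> minkowski_space \<Longrightarrow> w \<in> minkowski_space \<Longrightarrow> mink_diff z w \<in> minkowski_space"
  by (auto simp: minkowski_space_def mink_diff_def cnj_embedding)

lemma embedding_power: "\<sigma> \<in> embeddings \<Longrightarrow> \<sigma> (x ^ n) = \<sigma> x ^ n"
  by (induction n) (auto simp: embeddings_def)

lemma embedding_diff:
  assumes "\<sigma> \<in> embeddings"
  shows "\<sigma> (x - y) = \<sigma> x - \<sigma> y"
proof -
  have "\<sigma> (x - y) + \<sigma> y = \<sigma> x" 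
    using assms by (metis (mono_tags, lifting) diff_add_cancel embeddings_def mem_Collect_eq)
  then show ?thesis by (simp add: eq_diff_eq)
qed

lemma approx_error_class:
  "approx_error U z (star_class U a) (star_class U b) =
    star_class U (\<lambda>n. mink_diff (mink_mult (mink_embed (a n)) z) (mink_embed (b n)))"
  by (simp add: approx_error_def star_embed_def star_of_def star_map_class star_map2_class)

text \<open>The difference of the two errors has coordinates \<open>\<sigma> (b n - c n)\<close>, up
  to sign. There are finitely many embeddings, so along \<open>U\<close> all of these are below 1 at
  the same indices, where \<open>b n = c n\<close> follows.\<close>

lemma perp_unique:
  assumes "number_field TYPE('k::field_char_0)" and fin: "finite (embeddings :: ('k \<Rightarrow> complex) set)"
    and \<beta>: "\<beta> \<in> star U (ring_of_integers :: 'k set)" "approx_error U z (star_class U a) \<beta> \<in> mink_eps U"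
    and \<gamma>: "\<gamma> \<in> star U ring_of_integers" "approx_error U z (star_class U a) \<gamma> \<in> mink_eps U"
  shows "\<beta> = \<gamma>"
proof -
  obtain B where "finite_dimensional_vector_space (\<lambda>(r::rat) (x::'k). of_rat r * x) B"
    using assms(1) by (auto simp: number_field_def)
  then interpret rat_algebra B by (simp add: rat_algebra_def)
  obtain b c where bc: "\<beta> = star_class U b" "\<gamma> = star_class U c"
      "\<And>n. algebraic_int (b n)" "\<And>n. algebraic_int (c n)"
    using \<beta>(1) \<gamma>(1) by (auto simp: star_def ring_of_integers_def)
  have "\<forall>\<^sub>F n in U. cmod (\<sigma> (b n - c n)) < 1" if \<sigma>: "\<sigma> \<in> embeddings" for \<sigma>
  proof -
    note tendsto_diff[OF
        star_class_mink_epsD[OF \<gamma>(2)[unfolded bc approx_error_class] \<sigma>]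
        star_class_mink_epsD[OF \<beta>(2)[unfolded bc approx_error_class] \<sigma>]]
    then have "((\<lambda>n. \<sigma> (b n - c n)) \<longlongrightarrow> 0) U"
      using \<sigma> by (simp add: mink_diff_def mink_embed_def embedding_diff)
    then show ?thesis by (auto simp: tendsto_iff)
  qed
  then have "\<forall>\<^sub>F n in U. \<forall>\<sigma>\<in>embeddings. cmod (\<sigma> (b n - c n)) < 1"
    by (intro eventually_ball_finite fin) blast
  then have "\<forall>\<^sub>F n in U. b n = c n"
    by eventually_elim (intro algebraic_int_eqI bc, auto)
  then show ?thesis by (simp add: bc star_class_eq_iff)
qed

section \<open>The Pisot--Vijayaraghavan case\<close>

text \<open>Two indices with value \<open>t\<close> would make \<open>t\<close> a double root, hence
  a root of the derivative, a nonzero rational polynomial of smaller degree than the minimal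
  one.\<close>

lemma min_poly_simple_root:
  assumes m: "is_min_poly (map_poly of_int m) (t::real)"
    and split: "map_poly of_int m = (\<Prod>\<sigma>\<in>E. [:- g \<sigma>, 1::complex:])" and "finite E"
    and mem: "\<sigma> \<in> E" "\<rho> \<in> E" "g \<sigma> = of_real t" "g \<rho> = of_real t"
  shows "\<sigma> = \<rho>"
proof (rule ccontr)
  assume ne: "\<sigma> \<noteq> \<rho>"
  let ?m = "map_poly of_int m :: rat poly"
  let ?l = "[:- complex_of_real t, 1:]"
  let ?c = "map_poly of_int m :: complex poly"
  have "?c = (\<Prod>\<sigma>\<in>{\<sigma>, \<rho>}. [:- g \<sigma>, 1:]) * (\<Prod>\<sigma>\<in>E - {\<sigma>, \<rho>}. [:- g \<sigma>, 1:])"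
    unfolding split using mem \<open>finite E\<close> by (subst prod.subset_diff[of "{\<sigma>, \<rho>}"]) (auto simp: mult.commute)
  also have "(\<Prod>\<sigma>\<in>{\<sigma>, \<rho>}. [:- g \<sigma>, 1:]) = ?l * ?l"
    using ne mem by simp
  finally obtain r where r: "?c = ?l * (?l * r)" unfolding mult.assoc by blast
  have "poly (pderiv ?c) (of_real t) = 0"
    unfolding r pderiv_mult by simp
  moreover have "pderiv ?c = map_poly complex_of_real (map_poly of_rat (pderiv ?m))"
    by (intro poly_eqI) (simp add: coeff_pderiv coeff_map_poly of_rat_mult of_rat_add)
  ultimately have root: "poly (map_poly of_rat (pderiv ?m)) t = 0"
    by (simp add: of_real_hom.poly_map_poly_0)
  have "degree ?m \<noteq> 0"
  proof
    assume "degree ?m = 0"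
    then have "?m = 1" using m by (auto simp: is_min_poly_def one_pCons elim!: degree_eq_zeroE)
    then show False using m by (simp add: is_min_poly_def)
  qed
  then have "pderiv ?m \<noteq> 0" "degree (pderiv ?m) < degree ?m"
    by (simp_all add: pderiv_eq_0_iff degree_pderiv)
  then show False using m root by (auto simp: is_min_poly_def)
qed

theorem theorem30:
  fixes U :: "nat filter"
    and \<theta> :: real
    and vartheta :: "'k::field_char_0"
    and \<tau> :: "'k \<Rightarrow> complex"
    and m :: "int poly"
  assumes "nonprincipal_ultrafilter U"
    and "number_field TYPE('k)"
    and "pisot_vijayaraghavan \<theta>"
    and "vartheta \<in> ring_of_integers"
    and "\<tau> \<in> embeddings"
    and "complex_of_real \<theta> = \<tau> vartheta"
    and "map_poly of_int m = (\<Prod>\<tau>'\<in>embeddings. [:- \<tau>' vartheta, 1:])"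
    and "is_min_poly (map_poly of_int m) \<theta>"
  shows "\<exists>\<mu>\<in>PK_eps U. dioph_group_growth_decay U \<mu> \<mu> (mink_diag \<theta>) \<noteq> {star_of U (0::'k)}"
proof -
  let ?E = "embeddings :: ('k \<Rightarrow> complex) set"
  have bot: "U \<noteq> bot" using assms(1) by (simp add: nonprincipal_ultrafilter_def)
  have comp: "map_poly of_rat (map_poly of_int m :: rat poly) = (map_poly of_int m :: complex poly)"
    by (intro poly_eqI) (simp add: coeff_map_poly)
  \<comment> \<open>A product over an infinite set is 1 by convention, which would give
    \<open>m = 1\<close>, a polynomial without roots.\<close>
  have fin: "finite ?E"
  proof (rule ccontr)
    assume "infinite ?E"
    then have one: "(map_poly of_int m :: complex poly) = 1" using assms(7) by simp
    have "complex_of_int (coeff m i) = of_int (coeff 1 i)" for i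
      using arg_cong[OF one, of "\<lambda>p. coeff p i"] by (simp add: coeff_map_poly)
    then have "m = 1" by (intro poly_eqI) (simp only: of_int_eq_iff)
    then show False using assms(8) by (simp add: is_min_poly_def)
  qed
  have small: "cmod (\<sigma> vartheta) < 1" if "\<sigma> \<in> ?E" "\<sigma> \<noteq> \<tau>" for \<sigma>
  proof -
    have "poly (map_poly of_int m) (\<sigma> vartheta) = 0"
      unfolding assms(7) using that fin by (auto simp: poly_prod prod_zero_iff)
    then have "\<sigma> vartheta \<in> conjugates \<theta>"
      using assms(8) comp unfolding conjugates_def by auto
    \<comment> \<open>Simplicity of the root makes \<open>\<tau>\<close> the only embedding sending
      \<open>vartheta\<close> to \<open>\<theta>\<close>.\<close>
    moreover have "\<sigma> vartheta \<noteq> of_real \<theta>"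
      using min_poly_simple_root[OF assms(8,7) fin that(1) assms(5)] that(2) assms(6) by metis
    ultimately show ?thesis using assms(3) by (auto simp: pisot_vijayaraghavan_def)
  qed
  define \<alpha> where "\<alpha> = star_class U (\<lambda>n. vartheta ^ n)"
  define \<beta> where "\<beta> = star_class U (\<lambda>n. vartheta ^ Suc n)"
  define \<epsilon> :: "nat \<Rightarrow> 'k mink" where
    "\<epsilon> n = mink_diff (mink_mult (mink_embed (vartheta ^ n)) (mink_diag \<theta>))
       (mink_embed (vartheta ^ Suc n))" for n
  have err: "approx_error U (mink_diag \<theta>) \<alpha> \<beta> = star_class U \<epsilon>"
    unfolding \<alpha>_def \<beta>_def approx_error_class \<epsilon>_def ..
  have \<epsilon>_mem: "\<epsilon> n \<in> minkowski_space" for n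
    unfolding \<epsilon>_def by (intro mink_diff_mem mink_mult_mem mink_embed_mem mink_diag_mem)
  have \<epsilon>: "\<epsilon> n \<sigma> = \<sigma> vartheta ^ n * (of_real \<theta> - \<sigma> vartheta)" if "\<sigma> \<in> ?E" for \<sigma> n
    using that embedding_power[OF that, of vartheta "Suc n"] embedding_power[OF that, of vartheta n]
    by (simp add: \<epsilon>_def mink_diff_def mink_mult_def mink_embed_def mink_diag_def algebra_simps)
  have pow: "((\<lambda>n. \<sigma> vartheta ^ n) \<longlongrightarrow> 0) U" if "\<sigma> \<in> ?E" "\<sigma> \<noteq> \<tau>" for \<sigma>
    using LIMSEQ_power_zero[OF small[OF that]] nonprincipal_le_sequentially[OF assms(1)]
    by (rule tendsto_mono[rotated])
  have \<epsilon>_lim: "((\<lambda>n. \<epsilon> n \<sigma>) \<longlongrightarrow> 0) U" if "\<sigma> \<in> ?E" for \<sigma>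
  proof (cases "\<sigma> = \<tau>")
    case True
    then show ?thesis using assms(5,6) by (simp add: \<epsilon>)
  next
    case False
    then show ?thesis using that by (simp add: \<epsilon> pow tendsto_mult_left_zero)
  qed
  have eps: "star_class U \<epsilon> \<in> mink_eps U"
    by (rule star_class_mink_epsI[OF \<epsilon>_mem \<epsilon>_lim])
  have int: "\<alpha> \<in> star U ring_of_integers" "\<beta> \<in> star U ring_of_integers"
    using assms(4) algebraic_int_power unfolding \<alpha>_def \<beta>_def star_def ring_of_integers_def by blast+
  \<comment> \<open>\<open>err\<close> is defined through a definite description, so uniqueness is
    what identifies it with the class of \<open>\<epsilon>\<close>.\<close>
  have perp: "perp U (mink_diag \<theta>) \<alpha> = \<beta>"
    unfolding perp_def
  proof (rule the_equality)
    show "\<beta> \<in> star U ring_of_integers \<and> approx_error U (mink_diag \<theta>) \<alpha> \<beta> \<in> mink_eps U"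
      using int eps err by simp
    then show "\<gamma> = \<beta>" if "\<gamma> \<in> star U ring_of_integers \<and>
        approx_error U (mink_diag \<theta>) \<alpha> \<gamma> \<in> mink_eps U" for \<gamma>
      using that perp_unique[OF assms(2) fin] unfolding \<alpha>_def by blast
  qed
  define \<mu> where "\<mu> = mink_class U (star_class U \<epsilon>)"
  have \<mu>: "\<mu> \<in> PK_eps U" using eps by (simp add: \<mu>_def PK_eps_def)
  have "mink_growth_mult U (mink_class U (star_embed U \<alpha>)) \<mu> =
      mink_class U (star_class U (\<lambda>n. mink_mult (mink_embed (vartheta ^ n)) (\<epsilon> n)))"
    by (simp add: \<mu>_def \<alpha>_def star_embed_def star_map_class mink_growth_mult_class[OF assms(1)])
  moreover have "star_class U (\<lambda>n. mink_mult (mink_embed (vartheta ^ n)) (\<epsilon> n)) \<in> mink_eps U"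
  proof (rule star_class_mink_epsI)
    show "mink_mult (mink_embed (vartheta ^ n)) (\<epsilon> n) \<in> minkowski_space" for n
      by (intro mink_mult_mem mink_embed_mem \<epsilon>_mem)
    fix \<sigma> assume \<sigma>: "\<sigma> \<in> ?E"
    then have eq: "mink_mult (mink_embed (vartheta ^ n)) (\<epsilon> n) \<sigma> = \<sigma> vartheta ^ n * \<epsilon> n \<sigma>" for n
      by (simp add: mink_mult_def mink_embed_def embedding_power)
    show "((\<lambda>n. mink_mult (mink_embed (vartheta ^ n)) (\<epsilon> n) \<sigma>) \<longlongrightarrow> 0) U"
    \<comment> \<open>At \<open>\<tau>\<close> the powers of \<open>\<theta> > 1\<close> are
      unbounded, but \<open>\<epsilon>\<close> is exactly 0 there and absorbs them.\<close>
    proof (cases "\<sigma> = \<tau>")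
      case True
      then show ?thesis unfolding eq using assms(5,6) by (simp add: \<epsilon>)
    next
      case False
      then show ?thesis
        using tendsto_mult_zero[OF pow[OF \<sigma>] \<epsilon>_lim[OF \<sigma>]] by (simp add: eq)
    qed
  qed
  ultimately have "mink_growth_mult U (mink_class U (star_embed U \<alpha>)) \<mu> \<in> PK_eps U"
    by (simp add: PK_eps_def)
  moreover have "mink_growth_le U (mink_class U (err U (mink_diag \<theta>) \<alpha>)) \<mu>"
    by (simp add: err_def perp err \<mu>_def mink_growth_le_refl[OF bot])
  moreover have "\<alpha> \<in> dioph_group U (mink_diag \<theta>)"
    using int eps unfolding dioph_group_def err[symmetric] by blast
  ultimately have mem: "\<alpha> \<in> dioph_group_growth_decay U \<mu> \<mu> (mink_diag \<theta>)"
    by (simp add: dioph_group_growth_decay_def)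
  have "\<alpha> \<noteq> star_of U 0"
  proof
    assume "\<alpha> = star_of U 0"
    then have "\<forall>\<^sub>F n in U. vartheta ^ n = 0" by (simp add: \<alpha>_def star_of_def star_class_eq_iff)
    then obtain n where "vartheta ^ n = 0" using eventually_happens'[OF bot] by blast
    then have "\<tau> vartheta = \<tau> 0" by simp
    also have "\<tau> 0 = 0" using embedding_diff[OF assms(5), of 0 0] by simp
    finally show False using assms(3,6) by (simp add: pisot_vijayaraghavan_def)
  qed
  then show ?thesis using mem \<mu> by blast
qed

end
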